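(* The map $\delta$ is a bijection from the set of permutations of $\{1,\ldots,n\}$ to the set of noncrossing arc diagrams on $n$ points.
   Context: Noncrossing arc diagrams: place points $1,\ldots,n$ bottom to top on a vertical line; an arc joins $p<q$, moving monotonically upward and passing left or right of each point strictly between; arcs are considered up to combinatorial equivalence (determined by endpoints and which intermediate points lie to their left). A noncrossing arc diagram is a collection of arcs such that no two intersect except at endpoints and no two share an upper endpoint or a lower endpoint, considered up to combinatorial equivalence. Weak order: $x\le y$ iff $\operatorname{inv}(x)\subseteq\operatorname{inv}(y)$, where $\operatorname{inv}(x)$ is the set of pairs $(x_i,x_j)$, $i<j$, $x_i>x_j$. A permutation is join-irreducible in the weak order iff it has exactly one descent. A join-irreducible permutation $x$ with unique descent $x_i=b>x_{i+1}=a$ corresponds to the arc joining $a$ and $b$ in which each $c$ with $a<c<b$ lies to the left of the arc iff $c$ occurs in $x$ to the left of the descent; this is a bijection between join-irreducible permutations and arcs. The canonical join representation of $x$ in a finite lattice is the irredundant join representation $x=\bigvee S$ such that for every $T$ with $x=\bigvee T$ each element of $S$ lies below some element of $T$; in the weak order every permutation has one, consisting of join-irreducible permutations. The map $\delta$ sends a permutation $x$ to the set of arcs corresponding to the join-irreducible permutations in its canonical join representation. *)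

theory Defs
  imports
    "HOL-Analysis.Analysis"
    "HOL-Combinatorics.Permutations"
    "HOL-Algebra.Lattice"
begin

section \<open>The weak order\<close>

text \<open>A permutation \<open>x\<close> of \<open>{1..n}\<close> is a function with \<open>x permutes {1..n}\<close>; the entry
  written \<open>x\<^sub>i\<close> in one-line notation is \<open>x i\<close>. Inversions are pairs of values, not of positions.\<close>

definition inversions :: "nat \<Rightarrow> (nat \<Rightarrow> nat) \<Rightarrow> (nat \<times> nat) set" where
  "inversions n x = {(x i, x j) | i j. 1 \<le> i \<and> i < j \<and> j \<le> n \<and> x i > x j}"

definition weak_order :: "nat \<Rightarrow> (nat \<Rightarrow> nat) gorder" where
  "weak_order n =
     \<lparr>carrier = {x. x permutes {1..n}}, eq = (=), le = (\<lambda>x y. inversions n x \<subseteq> inversions n y)\<rparr>"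

section \<open>Canonical join representations\<close>

text \<open>\<open>S\<close> may be empty, in which case it represents the least element.\<close>

definition canonical_join_rep :: "('a, 'b) gorder_scheme \<Rightarrow> 'a set \<Rightarrow> 'a \<Rightarrow> bool" where
  "canonical_join_rep L S x \<longleftrightarrow>
     S \<subseteq> carrier L \<and> is_lub L x S \<and>
     (\<forall>S'. S' \<subset> S \<longrightarrow> \<not> is_lub L x S') \<and>
     (\<forall>T. T \<subseteq> carrier L \<and> is_lub L x T \<longrightarrow> (\<forall>s\<in>S. \<exists>t\<in>T. s \<sqsubseteq>\<^bsub>L\<^esub> t))"

section \<open>Arcs and noncrossing arc diagrams\<close>

text \<open>An arc up to combinatorial equivalence: its lower endpoint, its upper endpoint, and the set
  of intermediate points lying to its left.\<close>

datatype arc_class = Arc (arc_bot: nat) (arc_top: nat) (arc_left: "nat set")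

text \<open>The point \<open>c\<close> is placed at \<open>(0, c)\<close> in the plane. The path \<open>\<gamma>\<close> is an arc in the given
  combinatorial class: it rises from \<open>(0, arc_bot \<alpha>)\<close> to \<open>(0, arc_top \<alpha>)\<close>, avoids all points in
  between, and has exactly the points of \<open>arc_left \<alpha>\<close> on its left.\<close>

definition draws_arc :: "nat \<Rightarrow> arc_class \<Rightarrow> (real \<Rightarrow> real \<times> real) \<Rightarrow> bool" where
  "draws_arc n \<alpha> \<gamma> \<longleftrightarrow>
     1 \<le> arc_bot \<alpha> \<and> arc_bot \<alpha> < arc_top \<alpha> \<and> arc_top \<alpha> \<le> n \<and>
     path \<gamma> \<and> pathstart \<gamma> = (0, real (arc_bot \<alpha>)) \<and> pathfinish \<gamma> = (0, real (arc_top \<alpha>)) \<and>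
     strict_mono_on {0..1} (\<lambda>t. snd (\<gamma> t)) \<and>
     (\<forall>c. arc_bot \<alpha> < c \<and> c < arc_top \<alpha> \<longrightarrow> (0, real c) \<notin> path_image \<gamma>) \<and>
     arc_left \<alpha> =
       {c. arc_bot \<alpha> < c \<and> c < arc_top \<alpha> \<and> (\<exists>u>0. (u, real c) \<in> path_image \<gamma>)}"

text \<open>A diagram up to combinatorial equivalence is a set of classes of arcs that can be drawn
  simultaneously without crossings. Since arcs in one diagram have distinct lower endpoints, a
  diagram never contains two arcs of the same class, so a set of classes loses nothing.\<close>

definition noncrossing_arc_diagrams :: "nat \<Rightarrow> arc_class set set" where
  "noncrossing_arc_diagrams n =
     {D. \<exists>\<Gamma>. (\<forall>\<alpha>\<in>D. draws_arc n \<alpha> (\<Gamma> \<alpha>)) \<and>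
        pairwise (\<lambda>\<alpha> \<beta>.
          path_image (\<Gamma> \<alpha>) \<inter> path_image (\<Gamma> \<beta>) \<subseteq>
            {pathstart (\<Gamma> \<alpha>), pathfinish (\<Gamma> \<alpha>)} \<inter> {pathstart (\<Gamma> \<beta>), pathfinish (\<Gamma> \<beta>)} \<and>
          arc_bot \<alpha> \<noteq> arc_bot \<beta> \<and> arc_top \<alpha> \<noteq> arc_top \<beta>) D}"

section \<open>From permutations to diagrams\<close>

definition is_descent :: "nat \<Rightarrow> (nat \<Rightarrow> nat) \<Rightarrow> nat \<Rightarrow> bool" where
  "is_descent n x i \<longleftrightarrow> 1 \<le> i \<and> i < n \<and> x i > x (i + 1)"

text \<open>Meaningful when \<open>x\<close> is join-irreducible, that is, has exactly one descent.\<close>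

definition arc_of_join_irreducible :: "nat \<Rightarrow> (nat \<Rightarrow> nat) \<Rightarrow> arc_class" where
  "arc_of_join_irreducible n x =
     (let i = (THE i. is_descent n x i); b = x i; a = x (i + 1)
      in Arc a b {c. a < c \<and> c < b \<and> (\<exists>j. 1 \<le> j \<and> j < i \<and> x j = c)})"

text \<open>Canonical join representations in the weak order exist, are unique, and consist of
  join-irreducible permutations.\<close>

definition delta :: "nat \<Rightarrow> (nat \<Rightarrow> nat) \<Rightarrow> arc_class set" where
  "delta n x =
     arc_of_join_irreducible n ` (THE S. canonical_join_rep (weak_order n) S x)"

end

theory Submission
  imports Defs
begin

text \<open>The canonical joinands of \<open>x\<close> are indexed by its descents: the joinand of a descent \<open>b a\<close> is the
  least element below \<open>x\<close> that inverts \<open>(b, a)\<close>, and it is needed because exchanging \<open>b\<close> and \<open>a\<close> in \<open>x\<close>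
  destroys only that inversion. So \<open>delta n x\<close> is the set of arcs of the descents of \<open>x\<close>, and \<open>x\<close>, being
  the join of the corresponding join-irreducibles, is determined by it. Conversely, the values
  \<open>1, ..., n\<close> are inserted one at a time into a word as a horizontal line sweeps the diagram upwards.
  By the intermediate value theorem, two noncrossing arcs never exchange sides, so at each height
  the arcs met by the line occur from left to right in the same order as their lower ends in the
  word, and the next value has a well-defined place among them.\<close>

section \<open>Positions and inversions\<close>

lemma permutes_interval_inv:
  assumes "x permutes {1..n::nat}"
  shows "p \<in> {1..n} \<Longrightarrow> inv x p \<in> {1..n}" "x (inv x p) = p" "inv x (x i) = i"
    "i \<in> {1..n} \<Longrightarrow> x i \<in> {1..n}" "inv x p = inv x q \<longleftrightarrow> p = q"
  using permutes_in_image[OF assms] permutes_in_image[OF permutes_inv[OF assms]]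
    permutes_inverses[OF assms]
  by simp_all (metis permutes_inverses(1)[OF assms])

lemma in_inversions_iff:
  assumes "x permutes {1..n}"
  shows "(p, q) \<in> inversions n x \<longleftrightarrow>
    p \<in> {1..n} \<and> q \<in> {1..n} \<and> q < p \<and> inv x p < inv x q"
proof
  assume "(p, q) \<in> inversions n x"
  then obtain i j where ij: "p = x i" "q = x j" "1 \<le> i" "i < j" "j \<le> n" "x i > x j"
    by (auto simp: inversions_def)
  then show "p \<in> {1..n} \<and> q \<in> {1..n} \<and> q < p \<and> inv x p < inv x q"
    using permutes_interval_inv(3,4)[OF assms] by auto
next
  assume *: "p \<in> {1..n} \<and> q \<in> {1..n} \<and> q < p \<and> inv x p < inv x q"
  then have "inv x p \<in> {1..n}" "inv x q \<in> {1..n}"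
    using permutes_interval_inv(1)[OF assms] by auto
  moreover have "x (inv x p) = p" "x (inv x q) = q"
    using permutes_interval_inv(2)[OF assms] by auto
  ultimately show "(p, q) \<in> inversions n x"
    unfolding inversions_def using * 
    by (intro CollectI exI[of _ "inv x p"] exI[of _ "inv x q"]) simp
qed

lemma not_before_iff:
  assumes "x permutes {1..n::nat}" "p \<noteq> q"
  shows "\<not> inv x p < inv x q \<longleftrightarrow> inv x q < inv x p"
  using permutes_interval_inv(5)[OF assms(1), of p q] assms(2) by linarith

text \<open>A rank formula: \<open>g\<close> maps the set on the right bijectively onto
  \<open>{1..g p}\<close>. It recovers a permutation from the order that it induces.\<close>

lemma permutes_interval_eq_card:
  assumes g: "g permutes {1..n::nat}" and p: "p \<in> {1..n}"
  shows "g p = card {q \<in> {1..n}. g q \<le> g p}"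
proof -
  have gp: "g p \<in> {1..n}" using permutes_in_image[OF g] p by blast
  have image: "g ` {q \<in> {1..n}. g q \<le> g p} = {1..g p}"
  proof (intro equalityI subsetI)
    fix r assume r: "r \<in> {1..g p}"
    then have "r \<in> g ` {1..n}" using gp unfolding permutes_image[OF g] by auto
    then obtain q where "q \<in> {1..n}" "r = g q" by blast
    then show "r \<in> g ` {q \<in> {1..n}. g q \<le> g p}" using r by auto
  next
    fix r assume "r \<in> g ` {q \<in> {1..n}. g q \<le> g p}"
    then obtain q where q: "q \<in> {1..n}" "g q \<le> g p" "r = g q" by auto
    have "g q \<in> {1..n}" using permutes_in_image[OF g] q(1) by blast
    then show "r \<in> {1..g p}" using q by auto
  qed
  have "card {q \<in> {1..n}. g q \<le> g p} = card {1..g p}"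
    unfolding image[symmetric] by (rule card_image[OF permutes_inj_on[OF g], symmetric])
  then show ?thesis by simp
qed

text \<open>Antisymmetry of the weak order. The inversions tell, for any two values, which one
  stands first, and the position of a value is its rank in this order.\<close>

lemma inversions_inject:
  assumes x: "x permutes {1..n}" and y: "y permutes {1..n}"
    and eq: "inversions n x = inversions n y"
  shows "x = y"
proof -
  have before: "inv x p < inv x q \<longleftrightarrow> inv y p < inv y q"
    if "p \<in> {1..n}" "q \<in> {1..n}" "p \<noteq> q" for p q
    using that eq in_inversions_iff[OF x] in_inversions_iff[OF y]
      not_before_iff[OF x that(3)] not_before_iff[OF y that(3)]
    by (metis linorder_neqE_nat)
  have "inv x p = inv y p" for p
  proof (cases "p \<in> {1..n}")
    case True
    have "{q \<in> {1..n}. inv x q \<le> inv x p} = {q \<in> {1..n}. inv y q \<le> inv y p}"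
      using before[OF True] by (metis (no_types, lifting) Collect_cong linorder_not_le order_refl)
    then show ?thesis
      using permutes_interval_eq_card[OF permutes_inv[OF x] True]
        permutes_interval_eq_card[OF permutes_inv[OF y] True] by simp
  next
    case False
    then show ?thesis
      using permutes_inv[OF x] permutes_inv[OF y] by (simp add: permutes_def)
  qed
  then have "inv x = inv y" by blast
  then show ?thesis by (metis permutes_inv_inv x y)
qed

text \<open>Sorting the values by an injective key gives a one-line notation, so a permutation can
  be specified by the order of its values alone.\<close>

lemma permutation_of_key:
  fixes f :: "nat \<Rightarrow> nat"
  assumes f: "inj_on f {1..n}"
  shows "\<exists>x. x permutes {1..n} \<and> 
    (\<forall>p\<in>{1..n}. \<forall>q\<in>{1..n}. inv x p < inv x q \<longleftrightarrow> f p < f q)"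
proof -
  \<comment> \<open>\<open>g\<close> gives the position of a value, namely the rank of its key; the
    permutation itself is therefore \<open>inv g\<close>.\<close>
  define g where "g p = (if p \<in> {1..n} then card {q \<in> {1..n}. f q \<le> f p} else p)" for p
  have less: "g p < g q" if "p \<in> {1..n}" "q \<in> {1..n}" "f p < f q" for p q
  proof -
    have "{r \<in> {1..n}. f r \<le> f p} \<subset> {r \<in> {1..n}. f r \<le> f q}"
      using that by (auto simp: psubset_eq set_eq_iff intro!: exI[of _ q])
    then have "card {r \<in> {1..n}. f r \<le> f p} < card {r \<in> {1..n}. f r \<le> f q}"
      by (intro psubset_card_mono) auto
    then show ?thesis using that by (simp add: g_def)
  qed
  have iff: "g p < g q \<longleftrightarrow> f p < f q" if "p \<in> {1..n}" "q \<in> {1..n}" for p q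
    using less[OF that] less[OF that(2,1)] that f
    by (metis inj_onD linorder_neqE_nat not_less_iff_gr_or_eq)
  have inj: "inj_on g {1..n}"
    using iff f by (intro inj_onI) (metis inj_onD linorder_neqE_nat nat_less_le)
  have "g p \<in> {1..n}" if "p \<in> {1..n}" for p
  proof -
    have "card {q \<in> {1..n}. f q \<le> f p} \<le> card {1..n}" by (intro card_mono) auto
    moreover have "card {q \<in> {1..n}. f q \<le> f p} > 0"
      using that by (subst card_gt_0_iff) auto
    ultimately show ?thesis using that unfolding g_def by simp
  qed
  then have "g ` {1..n} = {1..n}"
    using card_image[OF inj] by (intro card_subset_eq) blast+
  then have "g permutes {1..n}"
    using inj by (intro bij_imp_permutes) (auto simp: bij_betw_def g_def)
  then have "inv g permutes {1..n}" "inv (inv g) = g"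
    by (auto simp: permutes_inv permutes_inv_inv)
  then show ?thesis using iff by (intro exI[of _ "inv g"]) simp
qed

lemma is_descentD:
  assumes x: "x permutes {1..n}" and d: "is_descent n x i"
  shows "x i \<in> {1..n}" "x (i + 1) \<in> {1..n}" "x (i + 1) < x i" 
    "inv x (x i) = i" "inv x (x (i + 1)) = i + 1"
  using d permutes_interval_inv(3,4)[OF x] by (auto simp: is_descent_def)

lemma is_descent_iff:
  assumes x: "x permutes {1..n}"
  shows "is_descent n x i \<longleftrightarrow> (\<exists>a b. a \<in> {1..n} \<and> b \<in> {1..n} \<and> a < b \<and>
     inv x b = i \<and> inv x a = i + 1)"
proof
  assume "is_descent n x i"
  then show "\<exists>a b. a \<in> {1..n} \<and> b \<in> {1..n} \<and> a < b \<and> inv x b = i \<and> inv x a = i + 1"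
    using is_descentD[OF x] by blast
next
  assume "\<exists>a b. a \<in> {1..n} \<and> b \<in> {1..n} \<and> a < b \<and> inv x b = i \<and> inv x a = i + 1"
  then obtain a b where ab: "a \<in> {1..n}" "b \<in> {1..n}" "a < b" "inv x b = i" "inv x a = i + 1"
    by blast
  then have "x i = b" "x (i + 1) = a" using permutes_interval_inv(2)[OF x] by metis+
  then show "is_descent n x i"
    using ab permutes_interval_inv(1)[OF x ab(1)] permutes_interval_inv(1)[OF x ab(2)]
    by (auto simp: is_descent_def)
qed

section \<open>Arcs of descents and join-irreducible permutations\<close>

text \<open>Applies to each descent of an arbitrary permutation, so that \<open>delta\<close> can be
  computed from \<open>x\<close> directly instead of from its joinands.\<close>

definition descent_arc :: "(nat \<Rightarrow> nat) \<Rightarrow> nat \<Rightarrow> arc_class" where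
  "descent_arc x i = Arc (x (i + 1)) (x i) {c. x (i + 1) < c \<and> c < x i \<and> inv x c < i}"

definition descent_arcs :: "nat \<Rightarrow> (nat \<Rightarrow> nat) \<Rightarrow> arc_class set" where
  "descent_arcs n x = descent_arc x ` {i. is_descent n x i}"

text \<open>The inversion set of the join-irreducible of \<open>Arc a b L\<close>. There
  \<open>L\<close> and \<open>b\<close> stand before \<open>a\<close> and the other values between
  \<open>a\<close> and \<open>b\<close>, and both groups are increasing; so an inversion takes its
  larger value from the first group and its smaller one from the second.\<close>

definition arc_inversions :: "arc_class \<Rightarrow> (nat \<times> nat) set" where
  "arc_inversions \<alpha> = {(p, q). q < p \<and> arc_bot \<alpha> \<le> q \<and> p \<le> arc_top \<alpha> \<and>
     (p = arc_top \<alpha> \<or> p \<in> arc_left \<alpha>) \<and> q \<notin> arc_left \<alpha>}"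

definition valid_arc :: "nat \<Rightarrow> arc_class \<Rightarrow> bool" where
  "valid_arc n \<alpha> \<longleftrightarrow> 1 \<le> arc_bot \<alpha> \<and> arc_bot \<alpha> < arc_top \<alpha> \<and> arc_top \<alpha> \<le> n \<and>
     arc_left \<alpha> \<subseteq> {arc_bot \<alpha><..<arc_top \<alpha>}"

text \<open>For \<open>\<alpha> = Arc a b L\<close> this is the permutation with one-line notation \<open>1 ... a-1\<close>, then \<open>L\<close> in
  increasing order, \<open>b\<close>, \<open>a\<close>, the remaining values between \<open>a\<close> and \<open>b\<close> in increasing order, and
  \<open>b+1 ... n\<close>.\<close>

definition join_irreducible_of_arc :: "nat \<Rightarrow> arc_class \<Rightarrow> nat \<Rightarrow> nat" where
  "join_irreducible_of_arc n \<alpha> =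
     (THE x. x permutes {1..n} \<and> inversions n x = arc_inversions \<alpha>)"

lemma join_irreducible_of_arc:
  assumes v: "valid_arc n \<alpha>"
  shows "join_irreducible_of_arc n \<alpha> permutes {1..n}"
    "inversions n (join_irreducible_of_arc n \<alpha>) = arc_inversions \<alpha>"
proof -
  obtain a b L where \<alpha>: "\<alpha> = Arc a b L" by (cases \<alpha>)
  have ab: "1 \<le> a" "a < b" "b \<le> n" "L \<subseteq> {a<..<b}"
    using v by (auto simp: valid_arc_def \<alpha>)
  \<comment> \<open>The offsets \<open>0\<close>, \<open>n\<close> and \<open>2 * n\<close> keep
    three increasing blocks apart: the values below \<open>a\<close>, \<open>L\<close> and
    \<open>b\<close>; then \<open>a\<close> and the rest below \<open>b\<close>; then the values
    above \<open>b\<close>.\<close>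
  define f where "f p = (if p < a \<or> p \<in> L \<or> p = b then p else if p < b then p + n else p + 2 * n)"
    for p
  have "inj_on f {1..n}"
    by (auto simp: inj_on_def f_def split: if_splits)
  then obtain x where x: "x permutes {1..n}"
    and key: "\<And>p q. p \<in> {1..n} \<Longrightarrow> q \<in> {1..n} \<Longrightarrow> inv x p < inv x q \<longleftrightarrow> f p < f q"
    using permutation_of_key by metis
  have "(p, q) \<in> inversions n x \<longleftrightarrow> (p, q) \<in> arc_inversions \<alpha>" for p q
  proof (cases "p \<in> {1..n} \<and> q \<in> {1..n}")
    case True
    then have "(p, q) \<in> inversions n x \<longleftrightarrow> q < p \<and> f p < f q"
      using in_inversions_iff[OF x] key by auto
    also have "\<dots> \<longleftrightarrow> (p, q) \<in> arc_inversions \<alpha>"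
      using True ab by (auto simp: arc_inversions_def \<alpha> f_def subset_iff)
    finally show ?thesis .
  next
    case False
    then show ?thesis
      using in_inversions_iff[OF x] ab by (auto simp: arc_inversions_def \<alpha>)
  qed
  then have "inversions n x = arc_inversions \<alpha>" by auto
  then have "\<exists>!x. x permutes {1..n} \<and> inversions n x = arc_inversions \<alpha>"
    using x inversions_inject by (intro ex1I[of _ x]) auto
  from theI'[OF this]
  show "join_irreducible_of_arc n \<alpha> permutes {1..n}"
    "inversions n (join_irreducible_of_arc n \<alpha>) = arc_inversions \<alpha>"
    by (auto simp: join_irreducible_of_arc_def)
qed

lemma before_iff_inversions:
  assumes "x permutes {1..n}" "p \<in> {1..n}" "q \<in> {1..n}"
  shows "inv x p < inv x q \<longleftrightarrow>
    (if q < p then (p, q) \<in> inversions n x else p \<noteq> q \<and> (q, p) \<notin> inversions n x)"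
  using in_inversions_iff[OF assms(1)] assms(2,3) not_before_iff[OF assms(1), of q p] by auto

lemma consecutive_positions:
  assumes x: "x permutes {1..n::nat}" and pq: "p \<in> {1..n}" "q \<in> {1..n}" "inv x p < inv x q"
    and none: "\<And>c. c \<in> {1..n} \<Longrightarrow> inv x p < inv x c \<Longrightarrow> \<not> inv x c < inv x q"
  shows "inv x q = inv x p + 1"
proof (rule ccontr)
  assume "inv x q \<noteq> inv x p + 1"
  then have "inv x p + 1 < inv x q" using pq(3) by linarith
  moreover have "inv x q \<in> {1..n}" using permutes_interval_inv(1)[OF x pq(2)] .
  ultimately have "x (inv x p + 1) \<in> {1..n}" by (intro permutes_interval_inv(4)[OF x]) auto
  from none[OF this] show False
    using \<open>inv x p + 1 < inv x q\<close> permutes_interval_inv(3)[OF x] by simp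
qed

text \<open>For \<open>\<alpha> = Arc a b L\<close>, an inversion \<open>(p, q)\<close> with
  \<open>p \<noteq> b\<close> has \<open>b\<close> strictly between \<open>p\<close> and
  \<open>q\<close> in the word, and one with \<open>q \<noteq> a\<close> has \<open>a\<close> there.
  Hence \<open>b a\<close> is the only descent.\<close>

lemma descent_of_join_irreducible_of_arc:
  fixes n \<alpha>
  defines "x \<equiv> join_irreducible_of_arc n \<alpha>"
  assumes v: "valid_arc n \<alpha>"
  shows "is_descent n x i \<longleftrightarrow> i = inv x (arc_top \<alpha>)"
    and "x (inv x (arc_top \<alpha>) + 1) = arc_bot \<alpha>"
proof -
  obtain a b L where \<alpha>: "\<alpha> = Arc a b L" by (cases \<alpha>)
  have ab: "1 \<le> a" "a < b" "b \<le> n" "L \<subseteq> {a<..<b}" "a \<in> {1..n}" "b \<in> {1..n}"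
    using v by (auto simp: valid_arc_def \<alpha>)
  have x: "x permutes {1..n}" and invs: "inversions n x = arc_inversions \<alpha>"
    using join_irreducible_of_arc[OF v] by (auto simp: x_def)
  have before: "inv x p < inv x q \<longleftrightarrow>
    (if q < p then (p, q) \<in> arc_inversions \<alpha> else p \<noteq> q \<and> (q, p) \<notin> arc_inversions \<alpha>)"
    if "p \<in> {1..n}" "q \<in> {1..n}" for p q
    using before_iff_inversions[OF x that] by (simp add: invs)
  have next_pos: "inv x a = inv x b + 1"
  proof (rule consecutive_positions[OF x])
    show "inv x b < inv x a" 
      using ab by (subst before) (auto simp: arc_inversions_def \<alpha>)
    show "\<not> inv x c < inv x a" if "c \<in> {1..n}" "inv x b < inv x c" for c
      using that ab by (auto simp: before arc_inversions_def \<alpha> split: if_splits)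
  qed (use ab in auto)
  have "p = b \<and> q = a" if pq: "p \<in> {1..n}" "q \<in> {1..n}" "q < p" "inv x q = inv x p + 1" for p q
  proof -
    have *: "(p, q) \<in> arc_inversions \<alpha>" using before[OF pq(1,2)] pq by auto
    have "p = b"
    proof (rule ccontr)
      assume "p \<noteq> b"
      then have "inv x p < inv x b" "inv x b < inv x q"
        using * pq(1-3) ab by (auto simp: before arc_inversions_def \<alpha>)
      then show False using pq by linarith
    qed
    moreover have "q = a"
    proof (rule ccontr)
      assume "q \<noteq> a"
      then have "inv x p < inv x a" "inv x a < inv x q"
        using * pq(1-3) ab by (auto simp: before arc_inversions_def \<alpha>)
      then show False using pq by linarith
    qed
    ultimately show ?thesis ..
  qed
  then show "is_descent n x i \<longleftrightarrow> i = inv x (arc_top \<alpha>)"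
    unfolding is_descent_iff[OF x] \<alpha> arc_class.sel using next_pos ab by metis
  show "x (inv x (arc_top \<alpha>) + 1) = arc_bot \<alpha>"
    using next_pos permutes_interval_inv(2)[OF x, of a] by (simp add: \<alpha>)
qed

lemma arc_of_join_irreducible_eq_descent_arc:
  assumes x: "x permutes {1..n}" and d: "is_descent n x i"
    and uniq: "\<And>j. is_descent n x j \<Longrightarrow> j = i"
  shows "arc_of_join_irreducible n x = descent_arc x i"
proof -
  have the: "(THE i. is_descent n x i) = i" using d uniq by (rule the_equality)
  have "(\<exists>j. 1 \<le> j \<and> j < i \<and> x j = c) \<longleftrightarrow> inv x c < i" if "x (i + 1) < c" "c < x i" for c
  proof -
    have "c \<in> {1..n}" using that is_descentD[OF x d] by auto
    then show ?thesis using permutes_interval_inv(1-3)[OF x]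
      by (metis atLeastAtMost_iff)
  qed
  then show ?thesis
    unfolding arc_of_join_irreducible_def the Let_def descent_arc_def by auto
qed

text \<open>The arc survives the passage to its join-irreducible: a value \<open>c\<close> between
  \<open>a\<close> and \<open>b\<close> precedes \<open>b\<close> iff \<open>(b, c)\<close> is not
  an inversion, which means \<open>c \<in> L\<close>.\<close>

lemma arc_of_join_irreducible_of_arc:
  assumes v: "valid_arc n \<alpha>"
  shows "arc_of_join_irreducible n (join_irreducible_of_arc n \<alpha>) = \<alpha>"
proof -
  define x where "x = join_irreducible_of_arc n \<alpha>"
  obtain a b L where \<alpha>: "\<alpha> = Arc a b L" by (cases \<alpha>)
  have ab: "1 \<le> a" "a < b" "b \<le> n" "L \<subseteq> {a<..<b}" "a \<in> {1..n}" "b \<in> {1..n}"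
    using v by (auto simp: valid_arc_def \<alpha>)
  have x: "x permutes {1..n}" and invs: "inversions n x = arc_inversions \<alpha>"
    using join_irreducible_of_arc[OF v] by (auto simp: x_def)
  note d = descent_of_join_irreducible_of_arc[OF v, folded x_def, unfolded \<alpha> arc_class.sel]
  have "inv x c < inv x b \<longleftrightarrow> c \<in> L" if "a < c" "c < b" for c
  proof -
    have "c \<in> {1..n}" using that ab by auto
    from before_iff_inversions[OF x this ab(6)] show ?thesis
      using that ab by (auto simp: invs arc_inversions_def \<alpha>)
  qed
  then have "descent_arc x (inv x b) = \<alpha>"
    using d(2) permutes_interval_inv(2)[OF x, of b] ab(4) by (auto simp: descent_arc_def \<alpha>)
  moreover have "arc_of_join_irreducible n x = descent_arc x (inv x b)"
    using d(1) by (intro arc_of_join_irreducible_eq_descent_arc[OF x]) auto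
  ultimately show ?thesis by (simp add: x_def)
qed

lemma valid_descent_arc:
  assumes "x permutes {1..n}" "is_descent n x i"
  shows "valid_arc n (descent_arc x i)"
  using is_descentD[OF assms] by (auto simp: valid_arc_def descent_arc_def)


section \<open>Canonical join representations in the weak order\<close>

lemma weak_order_simps [simp]:
  "x \<in> carrier (weak_order n) \<longleftrightarrow> x permutes {1..n}"
  "x \<sqsubseteq>\<^bsub>weak_order n\<^esub> y \<longleftrightarrow> inversions n x \<subseteq> inversions n y"
  by (auto simp: weak_order_def)

lemma is_lub_weak_order_iff:
  assumes "S \<subseteq> carrier (weak_order n)"
  shows "is_lub (weak_order n) x S \<longleftrightarrow> x permutes {1..n} \<and>
    (\<forall>s\<in>S. inversions n s \<subseteq> inversions n x) \<and>
    (\<forall>y. y permutes {1..n} \<longrightarrow> (\<forall>s\<in>S. inversions n s \<subseteq> inversions n y) \<longrightarrow>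
       inversions n x \<subseteq> inversions n y)"
proof -
  have "Upper (weak_order n) S =
    {y. y permutes {1..n} \<and> (\<forall>s\<in>S. inversions n s \<subseteq> inversions n y)}"
    using assms unfolding Upper_def set_eq_iff subset_eq[of S] Int_iff mem_Collect_eq
      weak_order_simps by blast
  then show ?thesis unfolding least_def using assms by auto
qed

section \<open>Uniqueness of joins and of canonical join representations\<close>

lemma is_lub_weak_order_unique:
  assumes "S \<subseteq> carrier (weak_order n)" "is_lub (weak_order n) x S" "is_lub (weak_order n) y S"
  shows "x = y"
  using assms unfolding is_lub_weak_order_iff[OF assms(1)] by (intro inversions_inject) auto

text \<open>If \<open>s\<close> lay below a different \<open>t\<close>, omitting \<open>s\<close>
  would leave the upper bounds unchanged, against irredundancy.\<close>

lemma canonical_join_rep_antichain: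
  assumes S: "canonical_join_rep (weak_order n) S x" and "s \<in> S" "t \<in> S"
    and le: "inversions n s \<subseteq> inversions n t"
  shows "s = t"
proof (rule ccontr)
  assume "s \<noteq> t"
  have sub: "S \<subseteq> carrier (weak_order n)" "S - {s} \<subseteq> carrier (weak_order n)"
    and lub: "is_lub (weak_order n) x S"
    using S by (auto simp: canonical_join_rep_def)
  have "inversions n s \<subseteq> inversions n y" if "\<forall>r\<in>S - {s}. inversions n r \<subseteq> inversions n y" for y
    using le bspec[OF that, of t] \<open>s \<noteq> t\<close> \<open>t \<in> S\<close> by simp
  then have "(\<forall>r\<in>S - {s}. inversions n r \<subseteq> inversions n y) \<longleftrightarrow>
    (\<forall>r\<in>S. inversions n r \<subseteq> inversions n y)" for y by blast
  then have "is_lub (weak_order n) x (S - {s})"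
    using lub unfolding is_lub_weak_order_iff[OF sub(1)] is_lub_weak_order_iff[OF sub(2)] by simp
  moreover have "S - {s} \<subset> S" using \<open>s \<in> S\<close> by blast
  ultimately show False using S by (auto simp: canonical_join_rep_def)
qed

text \<open>Used in both directions, this gives uniqueness. Refinement yields \<open>s\<close> below
  some \<open>t \<in> T\<close> below some \<open>s' \<in> S\<close>; the antichain property
  collapses this chain.\<close>

lemma canonical_join_rep_subset:
  assumes S: "canonical_join_rep (weak_order n) S x" and T: "canonical_join_rep (weak_order n) T x"
  shows "S \<subseteq> T"
proof
  fix s assume "s \<in> S"
  obtain t where t: "t \<in> T" "inversions n s \<subseteq> inversions n t"
    using S T \<open>s \<in> S\<close> unfolding canonical_join_rep_def weak_order_simps by meson
  obtain s' where s': "s' \<in> S" "inversions n t \<subseteq> inversions n s'"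
    using S T \<open>t \<in> T\<close> unfolding canonical_join_rep_def weak_order_simps by meson
  have "s = s'" using canonical_join_rep_antichain[OF S \<open>s \<in> S\<close> s'(1)] t s' by blast
  then have "inversions n s = inversions n t" using t s' by blast
  moreover have "s permutes {1..n}" "t permutes {1..n}"
    using S T \<open>s \<in> S\<close> t(1) by (auto simp: canonical_join_rep_def subset_iff)
  ultimately have "s = t" by (intro inversions_inject)
  then show "s \<in> T" using t by simp
qed

section \<open>The canonical join representation given by the descents\<close>

text \<open>Exchanging adjacent entries changes the relative order of that pair only. The resulting
  \<open>y\<close> serves as a test element: anything below \<open>x\<close> but not below
  \<open>y\<close> inverts \<open>(x i, x (i + 1))\<close>.\<close>

lemma swap_descent:
  assumes x: "x permutes {1..n}" and d: "is_descent n x i"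
  obtains y where "y permutes {1..n}" "inversions n y = inversions n x - {(x i, x (i + 1))}"
proof
  \<comment> \<open>Composition on the right exchanges the entries at positions \<open>i\<close> and
    \<open>i + 1\<close>.\<close>
  define y where "y = x \<circ> Transposition.transpose i (i + 1)"
  have "Transposition.transpose i (i + 1) permutes {1..n}"
    using d by (intro permutes_swap_id) (auto simp: is_descent_def)
  then show y: "y permutes {1..n}"
    unfolding y_def using x by (intro permutes_compose)
  have inv_y: "inv y p = Transposition.transpose i (i + 1) (inv x p)" for p
    unfolding y_def using permutes_bij[OF x] by (simp add: o_inv_distrib)
  have "(p, q) \<in> inversions n y \<longleftrightarrow> (p, q) \<in> inversions n x \<and> (p, q) \<noteq> (x i, x (i + 1))" for p q
  proof -
    have "q < p \<and> inv y p < inv y q \<longleftrightarrow>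
      q < p \<and> inv x p < inv x q \<and> \<not> (inv x p = i \<and> inv x q = i + 1)"
      using is_descentD(3)[OF x d] permutes_interval_inv(2)[OF x, of p] permutes_interval_inv(2)[OF x, of q]
      by (auto simp: inv_y Transposition.transpose_def split: if_splits)
    moreover have "p = x i \<longleftrightarrow> inv x p = i" "q = x (i + 1) \<longleftrightarrow> inv x q = i + 1"
      using permutes_interval_inv(2,3)[OF x] by metis+
    ultimately show ?thesis 
      unfolding in_inversions_iff[OF x] in_inversions_iff[OF y] by blast
  qed
  then show "inversions n y = inversions n x - {(x i, x (i + 1))}" by auto
qed

text \<open>In such a pair the larger value stands at a position at most \<open>i\<close> and the
  smaller one beyond \<open>i\<close>. So the joinand of the descent lies below
  \<open>x\<close>.\<close>

lemma arc_inversions_descent_arc_subset: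
  assumes x: "x permutes {1..n}" and d: "is_descent n x i"
  shows "arc_inversions (descent_arc x i) \<subseteq> inversions n x"
proof
  fix z assume "z \<in> arc_inversions (descent_arc x i)"
  then obtain p q where z: "z = (p, q)" "q < p" "x (i + 1) \<le> q" "p \<le> x i"
    "p = x i \<or> inv x p < i" "q = x (i + 1) \<or> \<not> inv x q < i"
    by (auto simp: arc_inversions_def descent_arc_def)
  have "inv x q \<noteq> i" using z permutes_interval_inv(2)[OF x, of q] by auto
  then have "inv x p \<le> i" "i < inv x q" using z is_descentD[OF x d] by auto
  then show "z \<in> inversions n x"
    using z is_descentD[OF x d] by (auto simp: in_inversions_iff[OF x])
qed

text \<open>Makes \<open>x\<close> the least upper bound of its joinands. By induction on the
  distance of the two positions: an entry between them in position and in value splits the inversion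
  into two shorter ones, which combine in \<open>y\<close> by transitivity; without such an entry,
  the arc of a single descent contains the inversion.\<close>

lemma inversion_below_join_of_descents:
  assumes x: "x permutes {1..n}" and y: "y permutes {1..n}"
    and ub: "\<And>i. is_descent n x i \<Longrightarrow> arc_inversions (descent_arc x i) \<subseteq> inversions n y"
  shows "inversions n x \<subseteq> inversions n y"
proof -
  have "(x i, x j) \<in> inversions n y" if "1 \<le> i" "i < j" "j \<le> n" "x j < x i" for i j
    using that
  proof (induction "j - i" arbitrary: i j rule: less_induct)
    case less
    show ?case
    proof (cases "\<exists>k. i < k \<and> k < j \<and> x j < x k \<and> x k < x i")
      case True
      then obtain k where "i < k" "k < j" "x j < x k" "x k < x i" by blast
      then have "(x i, x k) \<in> inversions n y" "(x k, x j) \<in> inversions n y"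
        using less by auto
      then show ?thesis unfolding in_inversions_iff[OF y] by auto
    next
      case False
      \<comment> \<open>All entries strictly between positions \<open>i\<close> and \<open>j\<close> lie outside \<open>x j..x i\<close>; the last one not
        below \<open>x i\<close> starts a descent whose arc spans both \<open>x i\<close> and \<open>x j\<close>.\<close>
      define k where "k = Max {k \<in> {i..<j}. x i \<le> x k}"
      have "k \<in> {k \<in> {i..<j}. x i \<le> x k}"
        unfolding k_def using less.prems by (intro Max_in) auto
      moreover have "k' \<le> k" if "k' \<in> {k \<in> {i..<j}. x i \<le> x k}" for k'
        unfolding k_def using that by (intro Max_ge) auto
      ultimately have k: "i \<le> k" "k < j" "x i \<le> x k"
        and max: "\<And>k'. k < k' \<Longrightarrow> k' < j \<Longrightarrow> x k' < x i"
        by auto (meson not_le less_le_trans order.strict_trans1 less_imp_le)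
      have "x (k + 1) \<le> x j"
      proof (cases "k + 1 = j")
        case False
        then have "x (k + 1) < x i" using max[of "k + 1"] k by auto
        then show ?thesis
          using \<open>\<not> (\<exists>k. i < k \<and> k < j \<and> x j < x k \<and> x k < x i)\<close> k False
          by (metis less_add_one linorder_not_le nat_less_le Suc_eq_plus1 Suc_leI order.strict_trans1)
      qed auto
      then have d: "is_descent n x k" using k less.prems by (auto simp: is_descent_def)
      have "x i = x k \<or> inv x (x i) < k" using k permutes_interval_inv(3)[OF x] 
        by (cases "i = k") auto
      moreover have "x j < x i" "\<not> inv x (x j) < k" 
        using k less.prems permutes_interval_inv(3)[OF x] by auto
      ultimately have "(x i, x j) \<in> arc_inversions (descent_arc x k)"
        using k \<open>x (k + 1) \<le> x j\<close> by (auto simp: arc_inversions_def descent_arc_def)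
      then show ?thesis using ub[OF d] by blast
    qed
  qed
  then show ?thesis by (auto simp: inversions_def[of n x])
qed

lemma canonical_join_rep_descents:
  assumes x: "x permutes {1..n}"
  shows "canonical_join_rep (weak_order n) (join_irreducible_of_arc n ` descent_arcs n x) x"
proof -
  define J where "J = (\<lambda>i. join_irreducible_of_arc n (descent_arc x i))"
  define S where "S = J ` {i. is_descent n x i}"
  have S_eq: "join_irreducible_of_arc n ` descent_arcs n x = S"
    by (auto simp: S_def J_def descent_arcs_def)
  have J: "J i permutes {1..n}" "inversions n (J i) = arc_inversions (descent_arc x i)"
    if "is_descent n x i" for i
    using join_irreducible_of_arc[OF valid_descent_arc[OF x that]] by (auto simp: J_def)
  have S: "S \<subseteq> carrier (weak_order n)" using J(1) by (auto simp: S_def)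
  have lub: "is_lub (weak_order n) x S"
    unfolding is_lub_weak_order_iff[OF S]
    using x J(2) arc_inversions_descent_arc_subset[OF x] inversion_below_join_of_descents[OF x]
    by (auto simp: S_def)
  have irredundant: "\<not> is_lub (weak_order n) x S'" if S'S: "S' \<subset> S" for S'
  proof
    assume lub': "is_lub (weak_order n) x S'"
    obtain i where i: "is_descent n x i" "J i \<notin> S'" using S'S unfolding S_def by blast
    obtain y where y: "y permutes {1..n}" "inversions n y = inversions n x - {(x i, x (i + 1))}"
      using swap_descent[OF x i(1)] by blast
    have S': "S' \<subseteq> carrier (weak_order n)" using that S by blast
    have "inversions n s \<subseteq> inversions n y" if "s \<in> S'" for s
    proof -
      obtain k where k: "is_descent n x k" "s = J k" "k \<noteq> i"
        using \<open>S' \<subset> S\<close> \<open>s \<in> S'\<close> i by (auto simp: S_def)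
      \<comment> \<open>An inversion of the arc at \<open>k\<close> has one value at a position at
        most \<open>k\<close> and the other beyond \<open>k\<close>. Positions \<open>i\<close> and
        \<open>i + 1\<close> are separated in this way only if \<open>k = i\<close>.\<close>
      have "(x i, x (i + 1)) \<notin> arc_inversions (descent_arc x k)"
        using is_descentD[OF x i(1)] is_descentD[OF x k(1)] k(3)
        by (cases "k = Suc i") (auto simp: arc_inversions_def descent_arc_def)
      then show ?thesis
        using y k J(2) arc_inversions_descent_arc_subset[OF x k(1)] by auto
    qed
    then have "inversions n x \<subseteq> inversions n y"
      using lub' y(1) unfolding is_lub_weak_order_iff[OF S'] by blast
    moreover have "(x i, x (i + 1)) \<in> inversions n x"
      using is_descentD[OF x i(1)] by (auto simp: in_inversions_iff[OF x])
    ultimately show False using y(2) by blast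
  qed
  have canonical: "\<exists>t\<in>T. inversions n (J i) \<subseteq> inversions n t"
    if T: "T \<subseteq> carrier (weak_order n)" "is_lub (weak_order n) x T" and i: "is_descent n x i" for T i
  proof -
    obtain y where y: "y permutes {1..n}" "inversions n y = inversions n x - {(x i, x (i + 1))}"
      using swap_descent[OF x i] by blast
    have "(x i, x (i + 1)) \<in> inversions n x"
      using is_descentD[OF x i] by (auto simp: in_inversions_iff[OF x])
    \<comment> \<open>Otherwise the join \<open>x\<close> of \<open>T\<close> would lie below
      \<open>y\<close>. The joinand that is not below \<open>y\<close> must contain the one
      inversion that \<open>y\<close> lacks.\<close>
    then have "\<not> (\<forall>t\<in>T. inversions n t \<subseteq> inversions n y)"
      using T y unfolding is_lub_weak_order_iff[OF T(1)] by blast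
    then obtain t where t: "t \<in> T" "(x i, x (i + 1)) \<in> inversions n t"
      "inversions n t \<subseteq> inversions n x"
      using T y unfolding is_lub_weak_order_iff[OF T(1)] by blast
    have tp: "t permutes {1..n}" using t(1) T(1) by auto
    \<comment> \<open>Since \<open>t\<close> lies below \<open>x\<close>, it inverts no pair that is
      increasing in \<open>x\<close>.\<close>
    have up: "inv t p < inv t q" if "p \<in> {1..n}" "q \<in> {1..n}" "p < q" "inv x p < inv x q" for p q
      using that t(3) before_iff_inversions[OF x that(1,2)] before_iff_inversions[OF tp that(1,2)]
      by auto
    have "z \<in> inversions n t" if zi: "z \<in> arc_inversions (descent_arc x i)" for z
    proof -
      have zx: "z \<in> inversions n x" using zi arc_inversions_descent_arc_subset[OF x i] by blast
      obtain p q where z: "z = (p, q)" "q < p" "x (i + 1) \<le> q" "p \<le> x i"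
        "p = x i \<or> inv x p < i" "q = x (i + 1) \<or> \<not> inv x q < i"
        using zi by (auto simp: arc_inversions_def descent_arc_def)
      have pq: "p \<in> {1..n}" "q \<in> {1..n}" using zx in_inversions_iff[OF x] z(1) by auto
      note d = is_descentD[OF x i]
      have "inv x q \<noteq> i" using z permutes_interval_inv(2)[OF x, of q] by auto
      \<comment> \<open>In \<open>t\<close> the values occur in the order \<open>p\<close>,
        \<open>x i\<close>, \<open>x (i + 1)\<close>, \<open>q\<close>, up to equality at either
        end: the outer comparisons come from \<open>up\<close>, the middle one from the choice of
        \<open>t\<close>.\<close>
      then have "p = x i \<or> inv t p < inv t (x i)" "q = x (i + 1) \<or> inv t (x (i + 1)) < inv t q"
        using up[OF pq(1) d(1)] up[OF d(2) pq(2)] z d permutes_interval_inv(5)[OF x, of q "x (i + 1)"]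
        by force+
      moreover have "inv t (x i) < inv t (x (i + 1))" using t(2) in_inversions_iff[OF tp] by auto
      ultimately have "inv t p < inv t q" by auto
      then show ?thesis using pq z by (simp add: in_inversions_iff[OF tp])
    qed
    then have "inversions n (J i) \<subseteq> inversions n t" unfolding J(2)[OF i] by blast
    then show ?thesis using t(1) by blast
  qed
  show ?thesis
    unfolding S_eq canonical_join_rep_def using S lub irredundant canonical
    by (auto simp: S_def)
qed

text \<open>Uniqueness of the representation evaluates the definite description. From here on
  \<open>delta\<close> is studied through the descents alone.\<close>

lemma delta_eq_descent_arcs:
  assumes x: "x permutes {1..n}"
  shows "delta n x = descent_arcs n x"
proof -
  have "(THE S. canonical_join_rep (weak_order n) S x) = 
    join_irreducible_of_arc n ` descent_arcs n x"
    using canonical_join_rep_descents[OF x] canonical_join_rep_subset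
    by (intro the_equality equalityI) auto
  moreover have "arc_of_join_irreducible n (join_irreducible_of_arc n \<alpha>) = \<alpha>"
    if "\<alpha> \<in> descent_arcs n x" for \<alpha>
    using that valid_descent_arc[OF x] arc_of_join_irreducible_of_arc
    by (auto simp: descent_arcs_def)
  ultimately show ?thesis by (simp add: delta_def image_image)
qed

lemma inj_on_descent_arcs: "inj_on (descent_arcs n) {x. x permutes {1..n}}"
proof (rule inj_onI)
  fix x y assume "x \<in> {x. x permutes {1..n}}" "y \<in> {x. x permutes {1..n}}"
    and eq: "descent_arcs n x = descent_arcs n y"
  then have "canonical_join_rep (weak_order n) (join_irreducible_of_arc n ` descent_arcs n x) x"
    "canonical_join_rep (weak_order n) (join_irreducible_of_arc n ` descent_arcs n x) y"
    using canonical_join_rep_descents[of x n] canonical_join_rep_descents[of y n] by simp_all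
  then show "x = y"
    unfolding canonical_join_rep_def by (elim conjE) (erule is_lub_weak_order_unique)
qed


section \<open>Drawing the arcs of a permutation\<close>

text \<open>Plot the value \<open>x\<^sub>i\<close> at \<open>(i, x\<^sub>i)\<close> and draw each descent as a segment. The segments lie in
  distinct vertical strips. A horizontal shear, depending continuously on the height, then moves
  all the plotted points onto the vertical axis.\<close>

lemma descent_arcs_noncrossing:
  assumes x: "x permutes {1..n}"
  shows "descent_arcs n x \<in> noncrossing_arc_diagrams n"
proof -
  \<comment> \<open>The shear: a sum of tent functions that interpolates the positions of the values
    piecewise linearly between integer heights.\<close>
  define s :: "real \<Rightarrow> real" where
    "s h = (\<Sum>k\<in>{1..n}. real (inv x k) * max 0 (1 - \<bar>h - real k\<bar>))" for h
  have s_nat: "s (real c) = real (inv x c)" if "c \<in> {1..n}" for c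
  proof -
    have "s (real c) = (\<Sum>k\<in>{1..n}. if k = c then real (inv x c) else 0)"
      unfolding s_def by (intro sum.cong) (auto simp: max_def)
    then show ?thesis using that by simp
  qed
  have s_cont: "continuous_on UNIV s"
    unfolding s_def by (intro continuous_intros)
  define h where "h \<alpha> t = real (arc_bot \<alpha>) + t * (real (arc_top \<alpha>) - real (arc_bot \<alpha>))" for \<alpha> t
  \<comment> \<open>With \<open>i\<close> the position of the top, this is the segment from
    \<open>(i + 1, arc_bot \<alpha>)\<close> to \<open>(i, arc_top \<alpha>)\<close> after the
    shear.\<close>
  define \<Gamma> where "\<Gamma> \<alpha> t = (real (inv x (arc_top \<alpha>)) + 1 - t - s (h \<alpha> t), h \<alpha> t)" for \<alpha> t
  have path_image: "(u, y) \<in> path_image (\<Gamma> \<alpha>) \<longleftrightarrow>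
    (\<exists>t\<in>{0..1}. y = h \<alpha> t \<and> u = real (inv x (arc_top \<alpha>)) + 1 - t - s y)" for u y \<alpha>
    by (auto simp: path_image_def \<Gamma>_def)
  have draws: "draws_arc n (descent_arc x i) (\<Gamma> (descent_arc x i))" if i: "is_descent n x i" for i
  proof -
    define \<alpha> where "\<alpha> = descent_arc x i"
    define a where "a = x (i + 1)"
    define b where "b = x i"
    have ends: "arc_bot \<alpha> = a" "arc_top \<alpha> = b" 
      and left: "arc_left \<alpha> = {c. a < c \<and> c < b \<and> inv x c < i}"
      by (auto simp: \<alpha>_def a_def b_def descent_arc_def)
    have ab: "a \<in> {1..n}" "b \<in> {1..n}" "a < b" "inv x b = i" "inv x a = i + 1"
      using is_descentD[OF x i] by (auto simp: a_def b_def)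
    have start: "pathstart (\<Gamma> \<alpha>) = (0, real a)" and finish: "pathfinish (\<Gamma> \<alpha>) = (0, real b)"
      using ab s_nat by (auto simp: pathstart_def pathfinish_def \<Gamma>_def h_def ends)
    have "continuous_on {0..1} (h \<alpha>)" unfolding h_def by (intro continuous_intros)
    then have path: "path (\<Gamma> \<alpha>)"
      unfolding path_def \<Gamma>_def
      by (intro continuous_intros continuous_on_compose2[OF s_cont]) auto
    have mono: "strict_mono_on {0..1} (\<lambda>t. snd (\<Gamma> \<alpha> t))"
      using ab(3) by (auto simp: strict_mono_on_def \<Gamma>_def h_def ends)
    have strict: "0 < t \<and> t < 1" if "t \<in> {0..1}" "real c = h \<alpha> t" "a < c" "c < b" for t c
    proof -
      have "t \<noteq> 0" "t \<noteq> 1" using that by (auto simp: h_def ends)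
      then show ?thesis using that(1) by auto
    qed
    \<comment> \<open>At an inner integer height the unsheared segment runs strictly between the
      positions \<open>i\<close> and \<open>i + 1\<close>, where no value is plotted.\<close>
    have avoid: "(0, real c) \<notin> path_image (\<Gamma> \<alpha>)" if c: "a < c" "c < b" for c
    proof
      assume "(0, real c) \<in> path_image (\<Gamma> \<alpha>)"
      then obtain t where t: "t \<in> {0..1}" "real c = h \<alpha> t" "0 = real i + 1 - t - s (real c)"
        unfolding path_image ends ab by blast
      have "s (real c) = real (inv x c)" using c ab by (intro s_nat) auto
      then have "real (inv x c) = real i + 1 - t" using t by simp
      then have "real i < real (inv x c)" "real (inv x c) < real (Suc i)"
        using strict[OF t(1,2) c] by auto
      then show False unfolding of_nat_less_iff by simp
    qed
    have "inv x c < i \<longleftrightarrow> (\<exists>u>0. (u, real c) \<in> path_image (\<Gamma> \<alpha>))" if c: "a < c" "c < b" for c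
    proof -
      define t where "t = (real c - real a) / (real b - real a)"
      have t: "t \<in> {0..1}" "real c = h \<alpha> t" using c by (auto simp: t_def h_def ends field_simps)
      have sc: "s (real c) = real (inv x c)" using c ab by (intro s_nat) auto
      have "inv x c \<noteq> i" using c ab(4) permutes_interval_inv(5)[OF x, of c b] by auto
      then have "inv x c < i \<longleftrightarrow> real i + 1 - t - s (real c) > 0" if 
        "t \<in> {0..1}" "real c = h \<alpha> t" for t
        using strict[OF that c] unfolding sc by linarith
      then show ?thesis unfolding path_image ends ab(4) using t by blast
    qed
    then have "draws_arc n \<alpha> (\<Gamma> \<alpha>)"
      unfolding draws_arc_def ends left using ab path start finish mono avoid by auto
    then show ?thesis by (simp add: \<alpha>_def)
  qed
  have shared: "path_image (\<Gamma> \<alpha>) \<inter> path_image (\<Gamma> \<beta>) \<subseteq>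
      {pathstart (\<Gamma> \<alpha>), pathfinish (\<Gamma> \<alpha>)} \<inter> {pathstart (\<Gamma> \<beta>), pathfinish (\<Gamma> \<beta>)}"
    if "inv x (arc_top \<alpha>) \<noteq> inv x (arc_top \<beta>)" for \<alpha> \<beta>
  proof
    fix z assume "z \<in> path_image (\<Gamma> \<alpha>) \<inter> path_image (\<Gamma> \<beta>)"
    then obtain t t' where t: "t \<in> {0..1}" "t' \<in> {0..1}" "z = \<Gamma> \<alpha> t" "z = \<Gamma> \<beta> t'"
      by (auto simp: path_image_def)
    \<comment> \<open>At a common point the heights agree, so the shear cancels. The unsheared
      segments lie in unit strips that meet at most along an edge, which forces the parameters to be
      \<open>0\<close> and \<open>1\<close>.\<close>
    then have "real (inv x (arc_top \<alpha>)) - t = real (inv x (arc_top \<beta>)) - t'"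
      by (auto simp: \<Gamma>_def)
    moreover have "real (inv x (arc_top \<alpha>)) + 1 \<le> real (inv x (arc_top \<beta>)) \<or>
      real (inv x (arc_top \<beta>)) + 1 \<le> real (inv x (arc_top \<alpha>))"
      using that by linarith
    ultimately have "t = 0 \<and> t' = 1 \<or> t = 1 \<and> t' = 0" using t(1,2) by auto
    then show "z \<in> {pathstart (\<Gamma> \<alpha>), pathfinish (\<Gamma> \<alpha>)} \<inter> {pathstart (\<Gamma> \<beta>), pathfinish (\<Gamma> \<beta>)}"
      using t(3,4) by (auto simp: pathstart_def pathfinish_def)
  qed
  have distinct: "arc_bot \<alpha> \<noteq> arc_bot \<beta> \<and> arc_top \<alpha> \<noteq> arc_top \<beta> \<and>
      inv x (arc_top \<alpha>) \<noteq> inv x (arc_top \<beta>)"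
    if \<alpha>: "\<alpha> \<in> descent_arcs n x" and \<beta>: "\<beta> \<in> descent_arcs n x" and "\<alpha> \<noteq> \<beta>" for \<alpha> \<beta>
  proof -
    obtain i j where "\<alpha> = descent_arc x i" "\<beta> = descent_arc x j"
      using \<alpha> \<beta> by (auto simp: descent_arcs_def)
    moreover from this have "i \<noteq> j" using \<open>\<alpha> \<noteq> \<beta>\<close> by auto
    ultimately show ?thesis
      using permutes_inj[OF x] permutes_interval_inv(3)[OF x]
      by (auto simp: descent_arc_def inj_eq)
  qed
  show ?thesis
    unfolding noncrossing_arc_diagrams_def pairwise_def
    using draws shared distinct by (intro CollectI exI[of _ \<Gamma>]) (auto simp: descent_arcs_def)
qed

section \<open>The sides of noncrossing arcs\<close>

text \<open>The sign of the horizontal coordinate of the arc at height \<open>c\<close>, for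
  \<open>c\<close> between its ends: positive if the arc passes to the right of the point.\<close>

definition side :: "arc_class \<Rightarrow> nat \<Rightarrow> int" where
  "side \<alpha> c = (if c = arc_bot \<alpha> \<or> c = arc_top \<alpha> then 0 else if c \<in> arc_left \<alpha> then 1 else -1)"

text \<open>Parametrises the arc by height, so that two arcs can be compared at equal heights. This
  is possible because the height is strictly increasing along the path.\<close>

lemma draws_arc_graph:
  assumes d: "draws_arc n \<alpha> \<gamma>"
  obtains f where "continuous_on {real (arc_bot \<alpha>)..real (arc_top \<alpha>)} f"
    "\<And>h. h \<in> {real (arc_bot \<alpha>)..real (arc_top \<alpha>)} \<Longrightarrow> (f h, h) \<in> path_image \<gamma>"
    "\<And>c. arc_bot \<alpha> \<le> c \<Longrightarrow> c \<le> arc_top \<alpha> \<Longrightarrow> sgn (f (real c)) = of_int (side \<alpha> c)"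
proof
  define a where "a = arc_bot \<alpha>"
  define b where "b = arc_top \<alpha>"
  define g where "g t = snd (\<gamma> t)" for t
  define f where "f h = fst (\<gamma> (inv_into {0..1} g h))" for h
  have ab: "a < b" and cont: "continuous_on {0..1} \<gamma>"
    and ends: "\<gamma> 0 = (0, real a)" "\<gamma> 1 = (0, real b)"
    and mono: "strict_mono_on {0..1} g"
    and avoid: "\<And>c. a < c \<Longrightarrow> c < b \<Longrightarrow> (0, real c) \<notin> path_image \<gamma>"
    and left: "arc_left \<alpha> = {c. a < c \<and> c < b \<and> (\<exists>u>0. (u, real c) \<in> path_image \<gamma>)}"
    using d by (auto simp: draws_arc_def a_def b_def path_def pathstart_def pathfinish_def
      g_def[abs_def])
  have g_cont: "continuous_on {0..1} g" unfolding g_def by (intro continuous_intros cont)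
  have g_inj: "inj_on g {0..1}" using mono by (rule strict_mono_on_imp_inj_on)
  have g_image: "g ` {0..1} = {real a..real b}"
  proof (intro equalityI subsetI)
    fix y assume "y \<in> g ` {0..1}"
    then obtain t where t: "t \<in> {0..1}" "y = g t" by blast
    have "g 0 \<le> g t" "g t \<le> g 1"
      using t(1) strict_mono_on_leD[OF mono] by auto
    then show "y \<in> {real a..real b}" using t ends by (simp add: g_def)
  next
    fix y assume "y \<in> {real a..real b}"
    then have "\<exists>t\<ge>0. t \<le> 1 \<and> g t = y"
      using ends by (intro IVT' g_cont) (auto simp: g_def)
    then show "y \<in> g ` {0..1}" by auto
  qed
  \<comment> \<open>A continuous injection on a compact set has a continuous inverse.\<close>
  have "continuous_on (g ` {0..1}) (inv_into {0..1} g)"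
    using g_cont g_inj by (intro continuous_on_inv) auto
  then have "continuous_on {real a..real b} (inv_into {0..1} g)" unfolding g_image .
  moreover have "inv_into {0..1} g ` {real a..real b} \<subseteq> {0..1}"
    using inv_into_into[of _ g "{0..1}"] unfolding g_image by blast
  ultimately show "continuous_on {real (arc_bot \<alpha>)..real (arc_top \<alpha>)} f"
    unfolding f_def a_def[symmetric] b_def[symmetric]
    by (intro continuous_intros continuous_on_compose2[OF cont])
  have on_graph: "u = f h" if "(u, h) \<in> path_image \<gamma>" for u h
  proof -
    obtain t where t: "t \<in> {0..1}" "\<gamma> t = (u, h)" using \<open>(u, h) \<in> path_image \<gamma>\<close> 
      by (auto simp: path_image_def)
    have "inv_into {0..1} g (g t) = t" using g_inj t(1) by (rule inv_into_f_f)
    then show ?thesis using t(2) by (simp add: f_def g_def)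
  qed
  show graph: "(f h, h) \<in> path_image \<gamma>" if "h \<in> {real (arc_bot \<alpha>)..real (arc_top \<alpha>)}" for h
  proof -
    have "h \<in> g ` {0..1}" using that by (simp add: g_image a_def b_def)
    then obtain t where t: "t \<in> {0..1}" "h = g t" by blast
    then have "\<gamma> t \<in> path_image \<gamma>" "\<gamma> t = (fst (\<gamma> t), h)" by (auto simp: path_image_def g_def)
    then show ?thesis using on_graph by metis
  qed
  show "sgn (f (real c)) = of_int (side \<alpha> c)" if c: "arc_bot \<alpha> \<le> c" "c \<le> arc_top \<alpha>" for c
  proof (cases "c = a \<or> c = b")
    case True
    have "\<gamma> 0 \<in> path_image \<gamma>" "\<gamma> 1 \<in> path_image \<gamma>" by (auto simp: path_image_def)
    then have "f (real a) = 0" "f (real b) = 0" using on_graph ends by metis+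
    then show ?thesis using True by (auto simp: side_def a_def b_def)
  next
    case False
    then have c': "a < c" "c < b" using c by (auto simp: a_def b_def)
    have gc: "(f (real c), real c) \<in> path_image \<gamma>" using c by (intro graph) auto
    then have "f (real c) \<noteq> 0" using avoid[OF c'] by auto
    moreover have "c \<in> arc_left \<alpha> \<longleftrightarrow> (\<exists>u>0. (u, real c) \<in> path_image \<gamma>)"
      unfolding left using c' by simp
    moreover have "\<dots> \<longleftrightarrow> f (real c) > 0" using gc on_graph by blast
    ultimately show ?thesis using False by (auto simp: side_def a_def b_def)
  qed
qed

text \<open>Were the sides exchanged, the intermediate value theorem for the difference of the
  horizontal coordinates would give a common point strictly between the heights \<open>c\<close> and
  \<open>c'\<close>, hence not an end of \<open>\<alpha>\<close>. The conclusion is weak because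
  both arcs may pass a point on the same side.\<close>

lemma noncrossing_side_le:
  assumes \<alpha>: "draws_arc n \<alpha> \<gamma>" and \<beta>: "draws_arc n \<beta> \<delta>"
    and shared: "path_image \<gamma> \<inter> path_image \<delta> \<subseteq> {pathstart \<gamma>, pathfinish \<gamma>}"
    and c: "arc_bot \<alpha> \<le> c" "c \<le> arc_top \<alpha>" "arc_bot \<beta> \<le> c" "c \<le> arc_top \<beta>"
    and c': "arc_bot \<alpha> \<le> c'" "c' \<le> arc_top \<alpha>" "arc_bot \<beta> \<le> c'" "c' \<le> arc_top \<beta>"
    and less: "side \<alpha> c < side \<beta> c"
  shows "side \<alpha> c' \<le> side \<beta> c'"
proof (rule ccontr)
  assume "\<not> side \<alpha> c' \<le> side \<beta> c'"
  then have less': "side \<beta> c' < side \<alpha> c'" by simp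
  obtain f where f: "continuous_on {real (arc_bot \<alpha>)..real (arc_top \<alpha>)} f"
    "\<And>h. h \<in> {real (arc_bot \<alpha>)..real (arc_top \<alpha>)} \<Longrightarrow> (f h, h) \<in> path_image \<gamma>"
    "\<And>c. arc_bot \<alpha> \<le> c \<Longrightarrow> c \<le> arc_top \<alpha> \<Longrightarrow> sgn (f (real c)) = of_int (side \<alpha> c)"
    using draws_arc_graph[OF \<alpha>] by blast
  obtain g where g: "continuous_on {real (arc_bot \<beta>)..real (arc_top \<beta>)} g"
    "\<And>h. h \<in> {real (arc_bot \<beta>)..real (arc_top \<beta>)} \<Longrightarrow> (g h, h) \<in> path_image \<delta>"
    "\<And>c. arc_bot \<beta> \<le> c \<Longrightarrow> c \<le> arc_top \<beta> \<Longrightarrow> sgn (g (real c)) = of_int (side \<beta> c)"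
    using draws_arc_graph[OF \<beta>] by blast
  have sgn_less: "u < v" if "sgn u < sgn v" for u v :: real
    using that by (auto simp: sgn_if split: if_splits)
  have "f (real c) < g (real c)"
    using less f(3)[OF c(1,2)] g(3)[OF c(3,4)] by - (rule sgn_less, simp)
  moreover have "g (real c') < f (real c')"
    using less' f(3)[OF c'(1,2)] g(3)[OF c'(3,4)] by - (rule sgn_less, simp)
  moreover define d where "d h = g h - f h" for h
  ultimately have d: "d (real c) > 0" "d (real c') < 0" by auto
  have d_cont: "continuous_on {real p..real q} d"
    if "p \<in> {c, c'}" "q \<in> {c, c'}" for p q
    unfolding d_def using that c c'
    by (intro continuous_intros continuous_on_subset[OF f(1)] continuous_on_subset[OF g(1)]) auto
  have "\<exists>h\<ge>min (real c) (real c'). h \<le> max (real c) (real c') \<and> d h = 0"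
  proof (cases "c \<le> c'")
    case True
    then show ?thesis using d IVT2'[of d "real c'" 0 "real c", OF _ _ _ d_cont] by auto
  next
    case False
    then show ?thesis using d IVT'[of d "real c'" 0 "real c", OF _ _ _ d_cont] by auto
  qed
  then obtain h where h: "min (real c) (real c') \<le> h" "h \<le> max (real c) (real c')" "d h = 0"
    by blast
  have "h \<noteq> real c" "h \<noteq> real c'" using d h(3) by auto
  then have "real (arc_bot \<alpha>) < h" "h < real (arc_top \<alpha>)" 
    "h \<in> {real (arc_bot \<beta>)..real (arc_top \<beta>)}"
    using h c c' by (auto simp: min_def max_def split: if_splits)
  moreover from this have "(f h, h) \<in> path_image \<gamma> \<inter> path_image \<delta>"
    using f(2)[of h] g(2)[of h] h(3) by (auto simp: d_def)
  moreover have "pathstart \<gamma> = (0, real (arc_bot \<alpha>))" "pathfinish \<gamma> = (0, real (arc_top \<alpha>))"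
    using \<alpha> by (auto simp: draws_arc_def)
  ultimately show False using shared by auto
qed

section \<open>Reconstructing a permutation from a diagram\<close>

text \<open>The combinatorial content of a drawing; the reconstruction of a permutation rests on
  these properties and no longer mentions paths.\<close>

locale arc_diagram =
  fixes n :: nat and D :: "arc_class set"
  assumes valid: "\<alpha> \<in> D \<Longrightarrow> valid_arc n \<alpha>"
    and bot_inject: "\<alpha> \<in> D \<Longrightarrow> \<beta> \<in> D \<Longrightarrow> arc_bot \<alpha> = arc_bot \<beta> \<Longrightarrow> \<alpha> = \<beta>"
    and top_inject: "\<alpha> \<in> D \<Longrightarrow> \<beta> \<in> D \<Longrightarrow> arc_top \<alpha> = arc_top \<beta> \<Longrightarrow> \<alpha> = \<beta>"
    and side_le: "\<alpha> \<in> D \<Longrightarrow> \<beta> \<in> D \<Longrightarrow>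
      c \<in> {arc_bot \<alpha>..arc_top \<alpha>} \<inter> {arc_bot \<beta>..arc_top \<beta>} \<Longrightarrow>
      c' \<in> {arc_bot \<alpha>..arc_top \<alpha>} \<inter> {arc_bot \<beta>..arc_top \<beta>} \<Longrightarrow>
      side \<alpha> c < side \<beta> c \<Longrightarrow> side \<alpha> c' \<le> side \<beta> c'"

lemma noncrossing_imp_arc_diagram:
  assumes "D \<in> noncrossing_arc_diagrams n"
  shows "arc_diagram n D"
proof -
  obtain \<Gamma> where draws: "\<And>\<alpha>. \<alpha> \<in> D \<Longrightarrow> draws_arc n \<alpha> (\<Gamma> \<alpha>)"
    and pw: "\<And>\<alpha> \<beta>. \<alpha> \<in> D \<Longrightarrow> \<beta> \<in> D \<Longrightarrow> \<alpha> \<noteq> \<beta> \<Longrightarrow>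
      path_image (\<Gamma> \<alpha>) \<inter> path_image (\<Gamma> \<beta>) \<subseteq>
        {pathstart (\<Gamma> \<alpha>), pathfinish (\<Gamma> \<alpha>)} \<inter> {pathstart (\<Gamma> \<beta>), pathfinish (\<Gamma> \<beta>)} \<and>
      arc_bot \<alpha> \<noteq> arc_bot \<beta> \<and> arc_top \<alpha> \<noteq> arc_top \<beta>"
    using assms unfolding noncrossing_arc_diagrams_def pairwise_def by blast
  show ?thesis
  proof
    fix \<alpha> assume "\<alpha> \<in> D"
    from draws[OF this] show "valid_arc n \<alpha>"
      unfolding draws_arc_def valid_arc_def by auto
  next
    fix \<alpha> \<beta> c c' assume *: "\<alpha> \<in> D" "\<beta> \<in> D"
      "c \<in> {arc_bot \<alpha>..arc_top \<alpha>} \<inter> {arc_bot \<beta>..arc_top \<beta>}"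
      "c' \<in> {arc_bot \<alpha>..arc_top \<alpha>} \<inter> {arc_bot \<beta>..arc_top \<beta>}"
      "side \<alpha> c < side \<beta> c"
    then have "\<alpha> \<noteq> \<beta>" by auto
    then show "side \<alpha> c' \<le> side \<beta> c'"
      using * pw[of \<alpha> \<beta>] by (intro noncrossing_side_le[OF draws draws, of \<alpha> \<beta> c c']) auto
  qed (use pw in blast)+
qed

context arc_diagram
begin

text \<open>The function \<open>f\<close> gives the positions of the values \<open>1..k\<close> in the word obtained from the wanted
  permutation by deleting all larger values. In that word the lower end of an arc with top above \<open>k\<close>
  may be preceded by a larger value that a later insertion will separate from it.\<close>

definition partial_word :: "nat \<Rightarrow> (nat \<Rightarrow> nat) \<Rightarrow> bool" where
  "partial_word k f \<longleftrightarrow> bij_betw f {1..k} {1..k} \<and>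
     (\<forall>\<alpha>\<in>D. arc_top \<alpha> \<le> k \<longrightarrow> f (arc_bot \<alpha>) = Suc (f (arc_top \<alpha>)) \<and>
        arc_left \<alpha> = {c. arc_bot \<alpha> < c \<and> c < arc_top \<alpha> \<and> f c < f (arc_top \<alpha>)}) \<and>
     (\<forall>a b. 1 \<le> a \<and> a < b \<and> b \<le> k \<and> f a = Suc (f b) \<longrightarrow>
        (\<exists>\<alpha>\<in>D. arc_bot \<alpha> = a \<and> (arc_top \<alpha> = b \<or> arc_top \<alpha> > k))) \<and>
     (\<forall>\<alpha>\<in>D. \<forall>c. arc_bot \<alpha> < c \<and> c \<le> k \<and> k < arc_top \<alpha> \<longrightarrow>
        (c \<in> arc_left \<alpha> \<longleftrightarrow> f c < f (arc_bot \<alpha>)))"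

text \<open>Insert \<open>k + 1\<close> immediately before the first lower end of an arc that ends at \<open>k + 1\<close> or passes to
  the right of it, and at the end of the word if there is none.\<close>

lemma partial_word_Suc:
  assumes f: "partial_word k f"
  shows "\<exists>f'. partial_word (Suc k) f'"
proof -
  have bij: "bij_betw f {1..k} {1..k}"
    and closed: "\<And>\<alpha>. \<alpha> \<in> D \<Longrightarrow> arc_top \<alpha> \<le> k \<Longrightarrow> f (arc_bot \<alpha>) = Suc (f (arc_top \<alpha>)) \<and>
        arc_left \<alpha> = {c. arc_bot \<alpha> < c \<and> c < arc_top \<alpha> \<and> f c < f (arc_top \<alpha>)}"
    and desc: "\<And>a b. 1 \<le> a \<Longrightarrow> a < b \<Longrightarrow> b \<le> k \<Longrightarrow> f a = Suc (f b) \<Longrightarrow>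
        \<exists>\<alpha>\<in>D. arc_bot \<alpha> = a \<and> (arc_top \<alpha> = b \<or> arc_top \<alpha> > k)"
    and active: "\<And>\<alpha> c. \<alpha> \<in> D \<Longrightarrow> arc_bot \<alpha> < c \<Longrightarrow> c \<le> k \<Longrightarrow> k < arc_top \<alpha> \<Longrightarrow>
        c \<in> arc_left \<alpha> \<longleftrightarrow> f c < f (arc_bot \<alpha>)"
    using f unfolding partial_word_def by simp_all
  have f_in: "f p \<in> {1..k}" if "p \<in> {1..k}" for p using bij that by (rule bij_betw_apply)
  have f_eq: "f p = f q \<longleftrightarrow> p = q" if "p \<in> {1..k}" "q \<in> {1..k}" for p q
    using bij_betw_imp_inj_on[OF bij] that by (rule inj_on_eq_iff)
  have bot: "arc_bot \<alpha> \<ge> 1" "arc_bot \<alpha> < arc_top \<alpha>" if "\<alpha> \<in> D" for \<alpha>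
    using valid[OF that] by (auto simp: valid_arc_def)
  have left: "arc_bot \<alpha> < c" "c < arc_top \<alpha>" if "\<alpha> \<in> D" "c \<in> arc_left \<alpha>" for \<alpha> c
    using valid[OF that(1)] that(2) by (auto simp: valid_arc_def)
  define A where "A = {arc_bot \<alpha> | \<alpha>. \<alpha> \<in> D \<and> arc_bot \<alpha> \<le> k \<and>
    (arc_top \<alpha> = Suc k \<or> Suc k \<in> arc_left \<alpha>)}"
  have A_sub: "A \<subseteq> {1..k}" using bot by (auto simp: A_def)
  then have "finite A" by (rule finite_subset) simp
  \<comment> \<open>The position of the new value; \<open>Suc k\<close> is the end of the word,
    chosen when \<open>A\<close> is empty.\<close>
  define m where "m = Min (insert (Suc k) (f ` A))"
  have m_in: "m = Suc k \<or> m \<in> f ` A"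
    using Min_in[of "insert (Suc k) (f ` A)"] \<open>finite A\<close> by (simp add: m_def)
  have m_le: "m \<le> Suc k" "\<And>a. a \<in> A \<Longrightarrow> m \<le> f a"
    unfolding m_def using \<open>finite A\<close> by (auto intro: Min_le)
  have "1 \<le> m" using m_in f_in A_sub by auto
  define f' where "f' p = (if p = Suc k then m else if f p < m then f p else Suc (f p))" for p
  have f'_new: "f' (Suc k) = m" by (simp add: f'_def)
  have f'_old: "f' p = (if f p < m then f p else Suc (f p))" if "p \<le> k" for p
    using that by (simp add: f'_def)
  have mono: "f' p < f' q \<longleftrightarrow> f p < f q" if "p \<le> k" "q \<le> k" for p q
    using that by (auto simp: f'_old)

  have inj: "inj_on f' {1..Suc k}"
    using f_eq by (auto simp: inj_on_def f'_def le_Suc_eq split: if_splits)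
  have "f' ` {1..Suc k} \<subseteq> {1..Suc k}"
    using f_in \<open>1 \<le> m\<close> m_le(1) by (force simp: f'_def)
  then have bij': "bij_betw f' {1..Suc k} {1..Suc k}"
    using inj by (simp add: bij_betw_def endo_inj_surj)

  have A_iff: "arc_bot \<alpha> \<in> A \<longleftrightarrow> arc_top \<alpha> = Suc k \<or> Suc k \<in> arc_left \<alpha>"
    if "\<alpha> \<in> D" "arc_bot \<alpha> \<le> k" for \<alpha>
    using that bot_inject unfolding A_def by blast

  \<comment> \<open>The insertion place is consistent: beyond it every open arc has its lower end in
    \<open>A\<close>, and an arc ending at \<open>k + 1\<close> has its lower end exactly there. The
    proof compares \<open>\<alpha>\<close> with the arc \<open>\<beta>\<close> whose lower end is at
    \<open>m\<close>.\<close>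
  have after: "arc_bot \<alpha> \<in> A \<and> (arc_top \<alpha> = Suc k \<longrightarrow> f (arc_bot \<alpha>) = m)"
    if \<alpha>: "\<alpha> \<in> D" "arc_bot \<alpha> \<le> k" "k < arc_top \<alpha>" and le: "m \<le> f (arc_bot \<alpha>)" for \<alpha>
  proof -
    define a where "a = arc_bot \<alpha>"
    have a: "a \<in> {1..k}" using bot[OF \<alpha>(1)] \<alpha>(2) by (auto simp: a_def)
    then have "m \<in> f ` A" using m_in f_in[OF a] le by (auto simp: a_def)
    then obtain a0 where a0: "a0 \<in> A" "m = f a0" by blast
    then obtain \<beta> where \<beta>: "\<beta> \<in> D" "arc_bot \<beta> = a0" "a0 \<le> k"
      "arc_top \<beta> = Suc k \<or> Suc k \<in> arc_left \<beta>" by (auto simp: A_def)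
    have "k < arc_top \<beta>" using \<beta>(4) left(2)[OF \<beta>(1), of "Suc k"] by auto
    show ?thesis
    proof (cases "a = a0")
      case True
      then show ?thesis using a0 by (simp add: a_def)
    next
      case False
      have a0k: "a0 \<in> {1..k}" using a0 A_sub by blast
      then have less: "f a0 < f a" using le a0(2) f_eq[OF a a0k] False by (auto simp: a_def)
      \<comment> \<open>The higher of the two lower ends is a height at which both arcs are present.
        One arc has side \<open>0\<close> there, and \<open>active\<close> reads the side of the
        other from the word.\<close>
      have side_less: "side \<beta> (max a0 a) < side \<alpha> (max a0 a)"
      proof (cases "a0 < a")
        case True
        then have "a \<notin> arc_left \<beta>" using active[OF \<beta>(1), of a] \<beta>(2) \<open>k < arc_top \<beta>\<close> a less by auto
        then show ?thesis using True \<beta>(2) \<open>k < arc_top \<beta>\<close> a by (auto simp: side_def a_def)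
      next
        case False
        then have "a < a0" using \<open>a \<noteq> a0\<close> by simp
        then have "a0 \<in> arc_left \<alpha>" using active[OF \<alpha>(1), of a0] \<alpha>(3) \<beta>(3) less by (auto simp: a_def)
        then show ?thesis using \<open>a < a0\<close> \<beta>(2,3) \<alpha>(3) by (auto simp: side_def a_def)
      qed
      have "side \<beta> (Suc k) \<le> side \<alpha> (Suc k)"
      proof (rule side_le[OF \<beta>(1) \<alpha>(1) _ _ side_less])
      qed (use \<alpha> \<beta>(2,3) \<open>k < arc_top \<beta>\<close> in \<open>auto simp: a_def\<close>)
      \<comment> \<open>So \<open>side \<alpha> (Suc k)\<close> is nonnegative. It is
        \<open>0\<close> only if both arcs end at \<open>k + 1\<close>, which distinct tops
        exclude.\<close>
      moreover have "side \<beta> (Suc k) = (if arc_top \<beta> = Suc k then 0 else 1)"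
        using \<beta> by (auto simp: side_def)
      ultimately have "arc_top \<alpha> = Suc k \<and> arc_top \<beta> = Suc k \<or> Suc k \<in> arc_left \<alpha>"
        using \<alpha>(2) by (auto simp: side_def split: if_splits)
      moreover have "\<not> (arc_top \<alpha> = Suc k \<and> arc_top \<beta> = Suc k)"
        using top_inject[OF \<alpha>(1) \<beta>(1)] \<beta>(2) \<open>a \<noteq> a0\<close> by (auto simp: a_def)
      ultimately show ?thesis using A_iff[OF \<alpha>(1,2)] left(2)[OF \<alpha>(1), of "Suc k"] by auto
    qed
  qed

  have closed': "f' (arc_bot \<alpha>) = Suc (f' (arc_top \<alpha>)) \<and>
      arc_left \<alpha> = {c. arc_bot \<alpha> < c \<and> c < arc_top \<alpha> \<and> f' c < f' (arc_top \<alpha>)}"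
    if \<alpha>: "\<alpha> \<in> D" "arc_top \<alpha> \<le> Suc k" for \<alpha>
  proof (cases "arc_top \<alpha> = Suc k")
    case True
    have botk: "arc_bot \<alpha> \<le> k" "k < arc_top \<alpha>" using bot[OF \<alpha>(1)] True by auto
    then have "arc_bot \<alpha> \<in> A" using A_iff[OF \<alpha>(1)] True by simp
    then have "f (arc_bot \<alpha>) = m" using after[OF \<alpha>(1) botk] m_le(2) True by blast
    then have pos: "f' (arc_bot \<alpha>) = Suc m" using f'_old[OF botk(1)] by simp
    have "c \<in> arc_left \<alpha> \<longleftrightarrow> f' c < m" if "arc_bot \<alpha> < c" "c < Suc k" for c
      using active[OF \<alpha>(1), of c] that botk \<open>f (arc_bot \<alpha>) = m\<close> f'_old[of c] by auto
    then show ?thesis using pos left[OF \<alpha>(1)] True by (auto simp: f'_new)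
  next
    case False
    then have top: "arc_top \<alpha> \<le> k" using \<alpha>(2) by simp
    \<comment> \<open>Nothing is inserted between the two ends of a closed arc: an element of
      \<open>A\<close> is the lower end of an arc with top above \<open>k\<close>, and lower ends
      determine arcs.\<close>
    have "m \<noteq> f (arc_bot \<alpha>)"
    proof
      assume m: "m = f (arc_bot \<alpha>)"
      have botk: "arc_bot \<alpha> \<in> {1..k}" using bot[OF \<alpha>(1)] top by auto
      then have "m \<in> f ` A" using m_in m f_in[OF botk] by auto
      then obtain a where "a \<in> A" "f (arc_bot \<alpha>) = f a" using m by auto
      then have "arc_bot \<alpha> \<in> A" using f_eq[OF botk, of a] A_sub by auto
      then show False using A_iff[OF \<alpha>(1)] botk left(2)[OF \<alpha>(1)] top False by fastforce
    qed
    then have "f' (arc_bot \<alpha>) = Suc (f' (arc_top \<alpha>))"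
      using closed[OF \<alpha>(1) top] bot(2)[OF \<alpha>(1)] top by (simp add: f'_old)
    moreover have "f' c < f' (arc_top \<alpha>) \<longleftrightarrow> f c < f (arc_top \<alpha>)" if "c < arc_top \<alpha>" for c
      using that top by (intro mono) auto
    ultimately show ?thesis using closed[OF \<alpha>(1) top] by auto
  qed

  have desc': "\<exists>\<alpha>\<in>D. arc_bot \<alpha> = a \<and> (arc_top \<alpha> = b \<or> arc_top \<alpha> > Suc k)"
    if ab: "1 \<le> a" "a < b" "b \<le> Suc k" "f' a = Suc (f' b)" for a b
  proof (cases "b = Suc k")
    case True
    then have "f a = m" using ab f'_old[of a] by (auto simp: f'_new split: if_splits)
    have ak: "a \<in> {1..k}" using ab True by simp
    then obtain a' where "a' \<in> A" "f a = f a'" using m_in f_in[OF ak] \<open>f a = m\<close> by auto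
    then have "a \<in> A" using f_eq[OF ak, of a'] A_sub by auto
    then show ?thesis using left(2) True unfolding A_def by fastforce
  next
    case False
    then have bk: "b \<le> k" "a \<le> k" using ab by auto
    have "f a \<noteq> f b" using f_eq[of a b] ab bk by auto
    \<comment> \<open>Old values adjacent after the insertion were adjacent before, and the new
      value did not go between them.\<close>
    then have "f a = Suc (f b)" "f a \<noteq> m"
      using ab(4) bk by (auto simp: f'_old split: if_splits)
    then obtain \<alpha> where \<alpha>: "\<alpha> \<in> D" "arc_bot \<alpha> = a" "arc_top \<alpha> = b \<or> arc_top \<alpha> > k"
      using desc ab bk by blast
    \<comment> \<open>Otherwise \<open>a\<close> would directly follow \<open>k + 1\<close>, which
      means \<open>f a = m\<close>.\<close>
    have "arc_top \<alpha> \<noteq> Suc k"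
      using closed'[of \<alpha>] \<alpha>(1,2) \<open>f a \<noteq> m\<close> f'_old[OF bk(2)] by (auto simp: f'_new split: if_splits)
    then show ?thesis using \<alpha> by auto
  qed

  have active': "c \<in> arc_left \<alpha> \<longleftrightarrow> f' c < f' (arc_bot \<alpha>)"
    if \<alpha>: "\<alpha> \<in> D" "Suc k < arc_top \<alpha>" and c: "arc_bot \<alpha> < c" "c \<le> Suc k" for \<alpha> c
  proof (cases "c = Suc k")
    case True
    then have botk: "arc_bot \<alpha> \<le> k" using c by simp
    have "Suc k \<in> arc_left \<alpha> \<longleftrightarrow> m \<le> f (arc_bot \<alpha>)"
      using after[OF \<alpha>(1) botk] m_le(2) A_iff[OF \<alpha>(1) botk] \<alpha>(2) by auto
    then show ?thesis using True f'_old[OF botk] by (auto simp: f'_new)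
  next
    case False
    then show ?thesis using active[OF \<alpha>(1), of c] \<alpha>(2) c mono[of c "arc_bot \<alpha>"] by auto
  qed

  have "partial_word (Suc k) f'"
    unfolding partial_word_def using bij' closed' desc' active' by blast
  then show ?thesis by blast
qed

lemma ex_partial_word: "\<exists>f. partial_word k f"
proof (induction k)
  case 0
  have "partial_word 0 id"
    using valid unfolding partial_word_def valid_arc_def by fastforce
  then show ?case by blast
qed (use partial_word_Suc in blast)

text \<open>At \<open>k = n\<close> no arc is open any more, so the clauses of
  \<open>partial_word\<close> match the descents with the arcs of \<open>D\<close>.\<close>

lemma ex_descent_arcs_eq: "\<exists>x. x permutes {1..n} \<and> descent_arcs n x = D"
proof -
  obtain f where f: "partial_word n f" using ex_partial_word by blast
  have bij: "bij_betw f {1..n} {1..n}"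
    and closed: "\<And>\<alpha>. \<alpha> \<in> D \<Longrightarrow> arc_top \<alpha> \<le> n \<Longrightarrow> f (arc_bot \<alpha>) = Suc (f (arc_top \<alpha>)) \<and>
        arc_left \<alpha> = {c. arc_bot \<alpha> < c \<and> c < arc_top \<alpha> \<and> f c < f (arc_top \<alpha>)}"
    and desc: "\<And>a b. 1 \<le> a \<Longrightarrow> a < b \<Longrightarrow> b \<le> n \<Longrightarrow> f a = Suc (f b) \<Longrightarrow>
        \<exists>\<alpha>\<in>D. arc_bot \<alpha> = a \<and> (arc_top \<alpha> = b \<or> arc_top \<alpha> > n)"
    using f unfolding partial_word_def by simp_all
  define g where "g p = (if p \<in> {1..n} then f p else p)" for p
  have "bij_betw g {1..n} {1..n}" using bij by (subst bij_betw_cong[of _ _ f]) (auto simp: g_def)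
  then have g: "g permutes {1..n}" by (intro bij_imp_permutes) (auto simp: g_def)
  \<comment> \<open>\<open>g\<close> sends values to positions, while one-line notation sends
    positions to values.\<close>
  define x where "x = inv g"
  have x: "x permutes {1..n}" unfolding x_def by (rule permutes_inv[OF g])
  have pos: "inv x p = f p" if "p \<in> {1..n}" for p
    using that permutes_inv_inv[OF g] by (simp add: x_def g_def)
  have top: "arc_top \<alpha> \<le> n" "arc_bot \<alpha> \<in> {1..n}" "arc_top \<alpha> \<in> {1..n}" "arc_bot \<alpha> < arc_top \<alpha>"
    if "\<alpha> \<in> D" for \<alpha>
    using valid[OF that] by (auto simp: valid_arc_def)
  have arc: "is_descent n x (f (arc_top \<alpha>)) \<and> descent_arc x (f (arc_top \<alpha>)) = \<alpha>"
    if \<alpha>: "\<alpha> \<in> D" for \<alpha>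
  proof -
    note t = top[OF \<alpha>]
    have b: "inv x (arc_bot \<alpha>) = f (arc_top \<alpha>) + 1" "inv x (arc_top \<alpha>) = f (arc_top \<alpha>)"
      using closed[OF \<alpha> t(1)] pos t by auto
    then have xs: "x (f (arc_top \<alpha>) + 1) = arc_bot \<alpha>" "x (f (arc_top \<alpha>)) = arc_top \<alpha>"
      using permutes_interval_inv(2)[OF x] by metis+
    have "{c. arc_bot \<alpha> < c \<and> c < arc_top \<alpha> \<and> inv x c < f (arc_top \<alpha>)} = arc_left \<alpha>"
      using closed[OF \<alpha> t(1)] pos t by auto
    then have "descent_arc x (f (arc_top \<alpha>)) = \<alpha>"
      unfolding descent_arc_def xs by simp
    then show ?thesis using b t unfolding is_descent_iff[OF x] by blast
  qed
  have "descent_arc x i \<in> D" if i: "is_descent n x i" for i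
  proof -
    note d = is_descentD[OF x i]
    have "f (x (i + 1)) = Suc (f (x i))" "f (x i) = i" using d pos by auto
    then obtain \<alpha> where "\<alpha> \<in> D" "arc_top \<alpha> = x i"
      using desc[of "x (i + 1)" "x i"] d top(1) by fastforce
    then show ?thesis using arc[of \<alpha>] \<open>f (x i) = i\<close> by auto
  qed
  then have "descent_arcs n x = D"
    using arc unfolding descent_arcs_def by (auto simp: image_iff) metis
  then show ?thesis using x by blast
qed

end

section \<open>Injectivity, drawing and reconstruction combined\<close>

theorem theorem3p1:
  fixes n :: nat
  shows "bij_betw (delta n) {x. x permutes {1..n}} (noncrossing_arc_diagrams n)"
proof -
  have "descent_arcs n ` {x. x permutes {1..n}} = noncrossing_arc_diagrams n"
  proof (intro equalityI subsetI)
    fix D assume "D \<in> descent_arcs n ` {x. x permutes {1..n}}"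
    then show "D \<in> noncrossing_arc_diagrams n" using descent_arcs_noncrossing by blast
  next
    fix D assume "D \<in> noncrossing_arc_diagrams n"
    then interpret arc_diagram n D by (rule noncrossing_imp_arc_diagram)
    show "D \<in> descent_arcs n ` {x. x permutes {1..n}}" using ex_descent_arcs_eq by blast
  qed
  then have "bij_betw (descent_arcs n) {x. x permutes {1..n}} (noncrossing_arc_diagrams n)"
    using inj_on_descent_arcs by (simp add: bij_betw_def)
  then show ?thesis using delta_eq_descent_arcs by (subst bij_betw_cong) auto
qed

end
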